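(* For every integer $m\ge 1$, the exponential generating function $\Gamma_m^{\mathcal{SP}}(x)$ of set partitions having $\mathrm{mex}$ equal to $m$ is $$\Gamma_m^{\mathcal{SP}}(x)=e^{e^x-1-\frac{x^m}{m!}}\prod_{k=1}^{m-1}\left(1-e^{-\frac{x^k}{k!}}\right).$$
   Context: A set partition of size $n$ is a partition of $\{1,2,\ldots,n\}$ into nonempty pairwise disjoint blocks (for $n=0$ there is exactly one, the empty set partition). The $\mathrm{mex}$ of a set partition is the minimum positive integer $k$ such that no block has cardinality $k$. The exponential generating function is $\Gamma_m^{\mathcal{SP}}(x)=\sum_{n\ge 0}\gamma_{n,m}^{\mathcal{SP}}\frac{x^n}{n!}$, where $\gamma_{n,m}^{\mathcal{SP}}$ is the number of set partitions of size $n$ having $\mathrm{mex}$ equal to $m$. *)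

theory Defs
  imports
    "HOL-Library.Disjoint_Sets"
    "HOL-Computational_Algebra.Formal_Power_Series"
begin

definition set_partitions :: "nat \<Rightarrow> nat set set set" where
  "set_partitions n = {P. partition_on {1..n} P}"

text \<open>The least positive integer that is not a block size.  It exists whenever there are finitely
  many blocks, as is the case for set partitions of \<open>{1..n}\<close>; the empty partition has mex 1.\<close>

definition mex :: "nat set set \<Rightarrow> nat" where
  "mex P = (LEAST k. 1 \<le> k \<and> (\<forall>B\<in>P. card B \<noteq> k))"

definition num_mex :: "nat \<Rightarrow> nat \<Rightarrow> nat" where
  "num_mex n m = card {P \<in> set_partitions n. mex P = m}"

definition egf_mex :: "nat \<Rightarrow> 'a :: field_char_0 fps" where
  "egf_mex m = Abs_fps (\<lambda>n. of_nat (num_mex n m) / fact n)"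

text \<open>The formal exponential of a power series; as a composition it has its usual meaning only for
  series with zero constant term.\<close>

definition exp_fps :: "'a :: field_char_0 fps \<Rightarrow> 'a fps" where
  "exp_fps f = fps_exp 1 oo f"

end

theory Submission
  imports Defs
begin

text \<open>Fix a set \<open>S\<close> of positive integers.  The block containing a distinguished point can be chosen
  freely among the sets of size in \<open>S\<close> through that point, and the other blocks partition what is
  left.  In terms of exponential generating functions this recursion is the differential equation
  \<open>E' = g' E\<close>, where \<open>g\<close> is the sum of \<open>x\<^sup>k / k!\<close> over \<open>k \<in> S\<close>; hence the set partitions with
  all block sizes in \<open>S\<close> have generating function \<open>exp g\<close> (lemma \<open>card_partitions_with_sizes\<close>).

  A set partition has mex \<open>m\<close> when no block has size \<open>m\<close> and each of \<open>1, \<dots>, m - 1\<close> is a block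
  size.  Forbidding a size \<open>k\<close> multiplies the generating function by \<open>exp (- x\<^sup>k / k!)\<close>.
  Requiring the size \<open>k\<close> is the complement of forbidding it, and so multiplies the generating
  function by \<open>1 - exp (- x\<^sup>k / k!)\<close>.  Imposing the requirements one size at a time, with an
  arbitrary set of sizes already forbidden, gives the product
  (lemma \<open>egf_required_forbidden_eq\<close>).\<close>

unbundle fps_syntax

section \<open>The exponential of a formal power series\<close>

text \<open>The equation for the difference of two solutions expresses each coefficient through earlier
  ones, all of which vanish.  The uniqueness yields the functional equation of \<open>exp_fps\<close>.\<close>

lemma fps_linear_ODE_unique:
  fixes F G h :: "'a :: field_char_0 fps"
  assumes "fps_deriv F = F * h" "fps_deriv G = G * h" "F $ 0 = G $ 0"
  shows "F = G"
proof -
  define D where "D = F - G"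
  have ode: "fps_deriv D = D * h"
    using assms by (simp add: D_def algebra_simps)
  have "D $ n = 0" for n
  proof (induction n rule: less_induct)
    case (less n)
    show ?case
    proof (cases n)
      case 0
      then show ?thesis using assms by (simp add: D_def)
    next
      case (Suc k)
      have "of_nat (k + 1) * D $ (k + 1) = (D * h) $ k"
        by (simp only: fps_deriv_nth flip: ode)
      also have "\<dots> = 0"
        using less Suc by (auto simp: fps_mult_nth intro!: sum.neutral)
      finally show ?thesis
        using Suc by (simp del: of_nat_Suc)
    qed
  qed
  then show ?thesis
    by (simp add: D_def fps_eq_iff)
qed

lemma exp_fps_nth_0 [simp]: "exp_fps f $ 0 = 1"
  by (simp add: exp_fps_def)

lemma fps_deriv_exp_fps:
  "f $ 0 = 0 \<Longrightarrow> fps_deriv (exp_fps f) = exp_fps f * fps_deriv f"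
  by (simp add: exp_fps_def fps_compose_deriv)

lemma exp_fps_add:
  assumes "f $ 0 = 0" "g $ 0 = 0"
  shows "exp_fps (f + g) = exp_fps f * exp_fps g"
proof (rule fps_linear_ODE_unique[where h = "fps_deriv f + fps_deriv g"])
  show "fps_deriv (exp_fps (f + g)) = exp_fps (f + g) * (fps_deriv f + fps_deriv g)"
    using assms by (simp add: fps_deriv_exp_fps)
  show "fps_deriv (exp_fps f * exp_fps g) =
      exp_fps f * exp_fps g * (fps_deriv f + fps_deriv g)"
    using assms by (simp add: fps_deriv_exp_fps algebra_simps)
qed simp

section \<open>Set partitions with prescribed block sizes\<close>

definition partitions_with_sizes :: "nat set \<Rightarrow> 'b set \<Rightarrow> 'b set set set" where
  "partitions_with_sizes S A = {P. partition_on A P \<and> card ` P \<subseteq> S}"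

definition sizes_egf :: "nat set \<Rightarrow> 'a :: field_char_0 fps" where
  "sizes_egf S = Abs_fps (\<lambda>k. if k \<in> S then 1 / fact k else 0)"

lemma finite_partitions_with_sizes: "finite A \<Longrightarrow> finite (partitions_with_sizes S A)"
  unfolding partitions_with_sizes_def
  by (rule finite_subset[OF _ finitely_many_partition_on]) auto

text \<open>A partition of \<open>insert x A\<close> is determined by the block \<open>insert x B\<close> of \<open>x\<close> together with the
  partition of \<open>A - B\<close> formed by the other blocks.\<close>

lemma bij_betw_partitions_insert:
  assumes "x \<notin> A" "finite A"
  shows "bij_betw (\<lambda>(B, Q). insert (insert x B) Q)
    (SIGMA B : {B. B \<subseteq> A \<and> Suc (card B) \<in> S}. partitions_with_sizes S (A - B))
    (partitions_with_sizes S (insert x A))"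
    (is "bij_betw ?f ?D ?R")
proof (rule bij_betw_imageI)
  have away: "x \<notin> p" "p \<noteq> {}" "p \<subseteq> A - B"
    if "p \<in> Q" "Q \<in> partitions_with_sizes S (A - B)" for p Q B
    using that assms by (auto simp: partitions_with_sizes_def partition_on_def)
  show "inj_on ?f ?D"
  proof (rule inj_onI, clarify)
    fix B Q B' Q'
    assume B: "B \<subseteq> A" "B' \<subseteq> A"
      and Q: "Q \<in> partitions_with_sizes S (A - B)" "Q' \<in> partitions_with_sizes S (A - B')"
      and eq: "insert (insert x B) Q = insert (insert x B') Q'"
    have notin: "insert x B \<notin> Q'" "insert x B' \<notin> Q" "insert x B \<notin> Q" "insert x B' \<notin> Q'"
      using away(1) Q by blast+
    with eq have "insert x B = insert x B'" by blast
    moreover have "x \<notin> B" "x \<notin> B'" using B assms by auto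
    ultimately have "B = B'" using insert_ident[of x B B'] by simp
    moreover from this have "Q = Q'" using eq notin insert_ident[of "insert x B" Q Q'] by simp
    ultimately show "B = B' \<and> Q = Q'" by blast
  qed
  show "?f ` ?D = ?R"
  proof (intro equalityI subsetI)
    fix P assume "P \<in> ?f ` ?D"
    then obtain B Q where B: "B \<subseteq> A" "Suc (card B) \<in> S"
      and Q: "Q \<in> partitions_with_sizes S (A - B)" and P: "P = insert (insert x B) Q"
      by auto
    have "disjnt (insert x B) (\<Union>Q)"
      using away[OF _ Q] by (auto simp: disjnt_def)
    moreover have "insert x A - insert x B = A - B"
      using assms by auto
    ultimately have "partition_on (insert x A) P"
      using Q B by (auto simp: P partition_on_insert partitions_with_sizes_def)
    moreover have "card (insert x B) = Suc (card B)"
      using B assms by (meson card_insert_disjoint finite_subset subsetD)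
    ultimately show "P \<in> ?R"
      using Q B by (auto simp: partitions_with_sizes_def P)
  next
    fix P assume P: "P \<in> ?R"
    then obtain p where p: "p \<in> P" "x \<in> p"
      by (auto simp: partitions_with_sizes_def partition_on_def)
    define B where "B = p - {x}"
    define Q where "Q = P - {p}"
    have part: "partition_on (insert x A) P" and sizes: "card ` P \<subseteq> S"
      using P by (auto simp: partitions_with_sizes_def)
    have p_eq: "p = insert x B" and P_eq: "P = insert p Q"
      using p by (auto simp: B_def Q_def)
    have "disjnt p (\<Union>Q)"
      using partition_onD2[OF part] p by (auto simp: Q_def disjnt_def disjoint_def)
    then have "partition_on (insert x A - p) Q" "p \<subseteq> insert x A"
      using part by (auto simp: P_eq partition_on_insert)
    moreover have "insert x A - p = A - B"
      using p assms by (auto simp: B_def)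
    ultimately have Q: "Q \<in> partitions_with_sizes S (A - B)" and B: "B \<subseteq> A"
      using sizes by (auto simp: partitions_with_sizes_def Q_def B_def)
    have "card p = Suc (card B)"
      unfolding p_eq using B assms by (meson card_insert_disjoint finite_subset subsetD)
    then have "Suc (card B) \<in> S"
      using sizes p(1) by auto
    then show "P \<in> ?f ` ?D"
      using Q B p_eq P_eq by (auto intro!: image_eqI[where x = "(B, Q)"])
  qed
qed

lemma sum_over_subsets_by_card:
  fixes h :: "nat \<Rightarrow> 'a :: comm_semiring_1"
  assumes "finite A"
  shows "(\<Sum>B\<in>Pow A. h (card B)) = (\<Sum>k\<le>card A. of_nat (card A choose k) * h k)"
proof -
  have "(\<Sum>B\<in>Pow A. h (card B)) = (\<Sum>k\<le>card A. \<Sum>B | B \<in> Pow A \<and> card B = k. h (card B))"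
    by (rule sum.group[symmetric]) (use assms in \<open>auto intro: card_mono\<close>)
  also have "\<dots> = (\<Sum>k\<le>card A. of_nat (card A choose k) * h k)"
    by (rule sum.cong) (use n_subsets[OF assms] in auto)
  finally show ?thesis .
qed

text \<open>The recursion on the block of a new point, with the binomial coefficient distributed over the
  factorials of the generating functions, is the coefficientwise form of the differential equation
  of \<open>exp_fps\<close>.\<close>

lemma card_partitions_with_sizes:
  assumes "finite A" "0 \<notin> S"
  shows "(of_nat (card (partitions_with_sizes S A)) :: 'a :: field_char_0) =
    fact (card A) * exp_fps (sizes_egf S) $ card A"
  using assms(1)
proof (induction A rule: finite_psubset_induct)
  case (psubset A)
  let ?E = "exp_fps (sizes_egf S) :: 'a fps"
  show ?case
  proof (cases "A = {}")
    case True
    then have "partitions_with_sizes S A = {{}}"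
      by (auto simp: partitions_with_sizes_def partition_on_empty)
    then show ?thesis using True by simp
  next
    case False
    then obtain x A' where A: "A = insert x A'" "x \<notin> A'"
      by (meson all_not_in_conv mk_disjoint_insert)
    have fin: "finite A'" using psubset A by simp
    define n where "n = card A'"
    have cA: "card A = Suc n" using A fin by (simp add: n_def)
    have "card (partitions_with_sizes S A) =
        card (SIGMA B : {B. B \<subseteq> A' \<and> Suc (card B) \<in> S}. partitions_with_sizes S (A' - B))"
      using bij_betw_same_card[OF bij_betw_partitions_insert[OF A(2) fin]] A by simp
    also have "\<dots> = (\<Sum>B | B \<subseteq> A' \<and> Suc (card B) \<in> S. card (partitions_with_sizes S (A' - B)))"
      using fin by (subst card_SigmaI) (auto intro!: finite_partitions_with_sizes)
    finally have "(of_nat (card (partitions_with_sizes S A)) :: 'a) =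
        (\<Sum>B | B \<subseteq> A' \<and> Suc (card B) \<in> S. of_nat (card (partitions_with_sizes S (A' - B))))"
      by simp
    also have "\<dots> = (\<Sum>B | B \<subseteq> A' \<and> Suc (card B) \<in> S. fact (n - card B) * ?E $ (n - card B))"
    proof (rule sum.cong[OF refl])
      fix B assume "B \<in> {B. B \<subseteq> A' \<and> Suc (card B) \<in> S}"
      then have "B \<subseteq> A'" by simp
      then have "card (A' - B) = n - card B"
        using fin by (simp add: n_def card_Diff_subset finite_subset)
      then show "of_nat (card (partitions_with_sizes S (A' - B))) =
          fact (n - card B) * ?E $ (n - card B)"
        using psubset.IH[of "A' - B"] A by auto
    qed
    also have "\<dots> = (\<Sum>B\<in>Pow A'. if Suc (card B) \<in> S
        then fact (n - card B) * ?E $ (n - card B) else 0)"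
      using fin by (intro sum.mono_neutral_cong_left) auto
    also have "\<dots> = (\<Sum>k\<le>n. of_nat (n choose k) *
        (if Suc k \<in> S then fact (n - k) * ?E $ (n - k) else 0))"
      unfolding n_def by (rule sum_over_subsets_by_card[OF fin])
    also have "\<dots> = (\<Sum>k\<le>n. fact n * (fps_deriv (sizes_egf S) $ k * ?E $ (n - k)))"
    proof (rule sum.cong[OF refl])
      fix k assume "k \<in> {..n}"
      then show "of_nat (n choose k) * (if Suc k \<in> S then fact (n - k) * ?E $ (n - k) else 0) =
          fact n * (fps_deriv (sizes_egf S) $ k * ?E $ (n - k))"
        by (simp add: sizes_egf_def binomial_fact divide_simps del: of_nat_Suc)
    qed
    also have "\<dots> = fact n * (fps_deriv (sizes_egf S) * ?E) $ n"
      by (simp add: fps_mult_nth sum_distrib_left atLeast0AtMost)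
    also have "\<dots> = fact n * fps_deriv ?E $ n"
      using assms(2) by (simp add: fps_deriv_exp_fps sizes_egf_def mult.commute)
    also have "\<dots> = fact (card A) * ?E $ card A"
      by (simp add: cA algebra_simps)
    finally show ?thesis .
  qed
qed

section \<open>Required and forbidden block sizes\<close>

definition partitions_required_forbidden :: "nat set \<Rightarrow> nat set \<Rightarrow> nat \<Rightarrow> nat set set set" where
  "partitions_required_forbidden R F n =
    {P \<in> set_partitions n. R \<subseteq> card ` P \<and> card ` P \<inter> F = {}}"

definition egf_required_forbidden :: "nat set \<Rightarrow> nat set \<Rightarrow> 'a :: field_char_0 fps" where
  "egf_required_forbidden R F =
    Abs_fps (\<lambda>n. of_nat (card (partitions_required_forbidden R F n)) / fact n)"

lemma finite_partitions_required_forbidden: "finite (partitions_required_forbidden R F n)"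
  unfolding partitions_required_forbidden_def set_partitions_def
  by (rule finite_subset[OF _ finitely_many_partition_on[of "{1..n}"]]) auto

lemma card_block_pos:
  assumes "P \<in> set_partitions n" "B \<in> P"
  shows "card B > 0"
proof -
  have "B \<subseteq> {1..n}" "B \<noteq> {}"
    using assms by (auto simp: set_partitions_def partition_on_def)
  then show ?thesis
    by (meson card_gt_0_iff finite_atLeastAtMost finite_subset)
qed

lemma egf_no_required:
  "egf_required_forbidden {} F = exp_fps (sizes_egf {k. 0 < k \<and> k \<notin> F})"
proof -
  have "partitions_required_forbidden {} F n =
      partitions_with_sizes {k. 0 < k \<and> k \<notin> F} {1..n}" for n
  proof -
    have "card ` P \<inter> F = {} \<longleftrightarrow> card ` P \<subseteq> {k. 0 < k \<and> k \<notin> F}"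
      if "P \<in> set_partitions n" for P
      using card_block_pos[OF that] by blast
    then show ?thesis
      by (auto simp: partitions_required_forbidden_def partitions_with_sizes_def
          set_partitions_def)
  qed
  then show ?thesis
    by (simp add: fps_eq_iff egf_required_forbidden_def card_partitions_with_sizes)
qed

text \<open>The partitions that meet the requirements \<open>R\<close> either have a block of size \<open>r\<close> or avoid that
  size.\<close>

lemma egf_insert_required:
  "egf_required_forbidden (insert r R) F =
    egf_required_forbidden R F - egf_required_forbidden R (insert r F)"
proof -
  have "card (partitions_required_forbidden R F n) =
      card (partitions_required_forbidden (insert r R) F n) +
      card (partitions_required_forbidden R (insert r F) n)" for n
  proof -
    have "partitions_required_forbidden R F n =
        partitions_required_forbidden (insert r R) F n \<union>
        partitions_required_forbidden R (insert r F) n"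
      and "partitions_required_forbidden (insert r R) F n \<inter>
        partitions_required_forbidden R (insert r F) n = {}"
      by (auto simp: partitions_required_forbidden_def)
    then show ?thesis
      by (simp add: card_Un_disjoint finite_partitions_required_forbidden)
  qed
  then show ?thesis
    by (simp add: fps_eq_iff egf_required_forbidden_def add_divide_distrib)
qed

lemma fps_X_power_div_fact:
  "(fps_X ^ k / fps_const (fact k) :: 'a :: field_char_0 fps) =
    Abs_fps (\<lambda>n. if n = k then 1 / fact k else 0)"
  by (simp add: fps_eq_iff fps_divide_unit fps_const_inverse fps_X_power_nth divide_inverse)

lemma exp_sizes_egf_forbid:
  fixes F :: "nat set"
  assumes "0 < r" "r \<notin> F"
  shows "(exp_fps (sizes_egf {k. 0 < k \<and> k \<notin> insert r F}) :: 'a :: field_char_0 fps) =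
    exp_fps (sizes_egf {k. 0 < k \<and> k \<notin> F}) * exp_fps (- (fps_X ^ r / fps_const (fact r)))"
proof -
  have "(sizes_egf {k. 0 < k \<and> k \<notin> insert r F} :: 'a fps) =
      sizes_egf {k. 0 < k \<and> k \<notin> F} + (- (fps_X ^ r / fps_const (fact r)))"
    using assms by (auto simp: fps_eq_iff sizes_egf_def fps_X_power_div_fact divide_inverse)
  then show ?thesis
    using assms by (simp only:) (rule exp_fps_add; simp add: sizes_egf_def fps_X_power_div_fact)
qed

text \<open>The induction needs \<open>F\<close> to vary, because removing a requirement \<open>r\<close> produces a term in which
  \<open>r\<close> is forbidden instead.\<close>

lemma egf_required_forbidden_eq:
  assumes "finite R" "0 \<notin> R" "R \<inter> F = {}"
  shows "(egf_required_forbidden R F :: 'a :: field_char_0 fps) =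
    exp_fps (sizes_egf {k. 0 < k \<and> k \<notin> F}) *
    (\<Prod>k\<in>R. 1 - exp_fps (- (fps_X ^ k / fps_const (fact k))))"
  using assms
proof (induction R arbitrary: F rule: finite_induct)
  case empty
  then show ?case by (simp add: egf_no_required)
next
  case (insert r R)
  let ?q = "\<lambda>k. exp_fps (- (fps_X ^ k / fps_const (fact k))) :: 'a fps"
  let ?E = "exp_fps (sizes_egf {k. 0 < k \<and> k \<notin> F}) :: 'a fps"
  have r: "0 < r" "r \<notin> F" and R: "0 \<notin> R" "R \<inter> F = {}" "R \<inter> Set.insert r F = {}"
    using insert by auto
  have "(egf_required_forbidden R F :: 'a fps) = ?E * (\<Prod>k\<in>R. 1 - ?q k)"
    by (rule insert.IH[OF R(1,2)])
  moreover have "(egf_required_forbidden R (Set.insert r F) :: 'a fps) =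
      ?E * ?q r * (\<Prod>k\<in>R. 1 - ?q k)"
    by (simp only: insert.IH[OF R(1,3)] exp_sizes_egf_forbid[OF r])
  ultimately show ?case
    by (simp only: egf_insert_required prod.insert[OF insert.hyps]
        left_diff_distrib right_diff_distrib mult_1_left mult.assoc)
qed

section \<open>The generating function of a given mex\<close>

lemma mex_eq_iff:
  assumes "finite P" "m \<ge> 1"
  shows "mex P = m \<longleftrightarrow> {1..m-1} \<subseteq> card ` P \<and> card ` P \<inter> {m} = {}"
proof -
  let ?missing = "\<lambda>k. 1 \<le> k \<and> (\<forall>B\<in>P. card B \<noteq> k)"
  \<comment> \<open>Finiteness gives a missing size, so that the minimum defining the mex is attained.\<close>
  obtain k where "k > Max (insert 0 (card ` P))" by blast
  then have "?missing k"
    using assms by auto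
  then have missing: "?missing (mex P)" and least: "\<And>j. ?missing j \<Longrightarrow> mex P \<le> j"
    unfolding mex_def by (rule LeastI) (rule Least_le)
  show ?thesis
  proof
    assume m: "mex P = m"
    have "j \<in> card ` P" if "j \<in> {1..m-1}" for j
      using least[of j] that m assms by force
    then show "{1..m-1} \<subseteq> card ` P \<and> card ` P \<inter> {m} = {}"
      using missing m by auto
  next
    assume *: "{1..m-1} \<subseteq> card ` P \<and> card ` P \<inter> {m} = {}"
    then have "mex P \<le> m"
      using assms by (intro least) auto
    moreover have "mex P \<notin> {1..m-1}"
    proof -
      have "mex P \<notin> card ` P" using missing by force
      then show ?thesis using * by blast
    qed
    ultimately show "mex P = m"
      using missing by auto
  qed
qed

theorem corollary7p1:
  fixes m :: nat
  assumes "m \<ge> 1"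
  shows "(egf_mex m :: 'a :: field_char_0 fps) =
    exp_fps (fps_exp 1 - 1 - fps_X ^ m / fps_const (fact m)) *
    (\<Prod>k=1..m-1. 1 - exp_fps (- (fps_X ^ k / fps_const (fact k))))"
proof -
  have "{P \<in> set_partitions n. mex P = m} = partitions_required_forbidden {1..m-1} {m} n" for n
  proof -
    have "finite P" if "P \<in> set_partitions n" for P
      using that finite_elements[of "{1..n}" P] by (simp add: set_partitions_def)
    then show ?thesis
      using mex_eq_iff[OF _ assms] by (auto simp: partitions_required_forbidden_def)
  qed
  then have "(egf_mex m :: 'a fps) = egf_required_forbidden {1..m-1} {m}"
    by (simp add: egf_mex_def num_mex_def egf_required_forbidden_def)
  also have "\<dots> = exp_fps (sizes_egf {k. 0 < k \<and> k \<notin> {m}}) *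
      (\<Prod>k=1..m-1. 1 - exp_fps (- (fps_X ^ k / fps_const (fact k))))"
    using assms by (intro egf_required_forbidden_eq) auto
  also have "(sizes_egf {k. 0 < k \<and> k \<notin> {m}} :: 'a fps) =
      fps_exp 1 - 1 - fps_X ^ m / fps_const (fact m)"
    using assms by (auto simp: fps_eq_iff sizes_egf_def fps_X_power_div_fact divide_inverse)
  finally show ?thesis .
qed

end
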